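(* Let $p\geq5$ be a prime, let $a\in\mathbb{Z}_p^{\times}$ be panmagic, and let $N:=\operatorname{ord}_p(a^2)+1$. If $N$ is odd, then all permutations in $\pi_aD_p$ have the same cycle type, with the cycle lengths, aside from the (single) fixed point, all equal to $2(N-1)$. If $N$ is even, then the permutations in $\pi_aD_p$ have two cycle types, with the cycle lengths, aside from the (single) fixed point, all equal to $N-1$ in one of them and all equal to $2(N-1)$ in the other.
   Context: $S_p$ is the group of permutations of $\{1,\dots,p\}$, identified with the group of permutations of the residues $\mathbb{Z}_p$ (with $p$ identified with the residue $0$). $\phi(i)\equiv 1-i$ is the flip and $\varkappa(i)\equiv i+1\pmod p$ is the cyclic shift; $D_p:=\langle\phi,\varkappa\rangle\le S_p$ is the dihedral group. For $a\in\mathbb{Z}_p^\times$ (the units of $\mathbb{Z}_p$), $\pi_a\in S_p$ is $\pi_a(i)\equiv ai\pmod p$, and $\pi_aD_p$ is the left coset. A unit $a\in\mathbb{Z}_p^\times$ is called panmagic if $a+1$ and $a-1$ are also units, i.e. $a\ne 0,\pm1$. $\operatorname{ord}_p(x)$ is the multiplicative order of $x\in\mathbb{Z}_p^\times$. The cycle type of a permutation is the number and lengths of the cycles in its disjoint cycle decomposition, with fixed points counted as cycles of length $1$. *)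

theory Defs
  imports
    "HOL-Algebra.Sym_Groups"
    "HOL-Algebra.Multiplicative_Group"
    "HOL-Combinatorics.Orbits"
    "HOL-Library.Multiset"
    "HOL-Number_Theory.Residues"
begin

(* The representative of a residue mod p in {1..p}: the residue 0 is represented by p. *)
definition residue_rep :: "nat \<Rightarrow> int \<Rightarrow> nat" where
  "residue_rep p x = (if int p dvd x then p else nat (x mod int p))"

lemma residue_rep_cong: "p > 0 \<Longrightarrow> [int (residue_rep p x) = x] (mod int p)"
  by (auto simp: residue_rep_def cong_def)

lemma residue_rep_in: "p > 0 \<Longrightarrow> residue_rep p x \<in> {1..p}"
proof -
  assume "p > 0"
  then have "0 \<le> x mod int p" "x mod int p < int p" by simp_all
  then show ?thesis using \<open>p > 0\<close>
    by (auto simp: residue_rep_def dvd_eq_mod_eq_0 le_less nat_less_iff)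
qed

(* The self-map of {1..p} induced by a map on residues; it is the identity outside {1..p},
   as required of elements of sym_group p. *)
definition residue_map :: "nat \<Rightarrow> (int \<Rightarrow> int) \<Rightarrow> nat \<Rightarrow> nat" where
  "residue_map p f = (\<lambda>i. if i \<in> {1..p} then residue_rep p (f (int i)) else i)"

definition flip :: "nat \<Rightarrow> nat \<Rightarrow> nat" where
  "flip p = residue_map p (\<lambda>i. 1 - i)"

definition cyclic_shift :: "nat \<Rightarrow> nat \<Rightarrow> nat" where
  "cyclic_shift p = residue_map p (\<lambda>i. i + 1)"

definition mult_perm :: "nat \<Rightarrow> int \<Rightarrow> nat \<Rightarrow> nat" where
  "mult_perm p a = residue_map p (\<lambda>i. a * i)"

definition dihedral :: "nat \<Rightarrow> (nat \<Rightarrow> nat) set" where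
  "dihedral p = generate (sym_group p) {flip p, cyclic_shift p}"

definition dihedral_coset :: "nat \<Rightarrow> int \<Rightarrow> (nat \<Rightarrow> nat) set" where
  "dihedral_coset p a = mult_perm p a <#\<^bsub>sym_group p\<^esub> dihedral p"

definition panmagic :: "nat \<Rightarrow> int \<Rightarrow> bool" where
  "panmagic p a \<longleftrightarrow>
     (let R = residue_ring (int p)
      in a \<in> Units R \<and> a \<oplus>\<^bsub>R\<^esub> \<one>\<^bsub>R\<^esub> \<in> Units R \<and> a \<ominus>\<^bsub>R\<^esub> \<one>\<^bsub>R\<^esub> \<in> Units R)"

(* The multiplicative order on residue units, for an element given by its representative
   in {0..<p}. *)
definition ord_mod :: "nat \<Rightarrow> int \<Rightarrow> nat" where
  "ord_mod p x = group.ord (units_of (residue_ring (int p))) x"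

(* The multiset of cycle lengths of a permutation of S. The orbits of points of S are the
   supports of the disjoint cycles, and a fixed point is a cycle of length 1. *)
definition cycle_type :: "'a set \<Rightarrow> ('a \<Rightarrow> 'a) \<Rightarrow> nat multiset" where
  "cycle_type S \<sigma> = image_mset card (mset_set (orbit \<sigma> ` S))"

definition all_lengths_but_one_fixed_point :: "nat multiset \<Rightarrow> nat \<Rightarrow> bool" where
  "all_lengths_but_one_fixed_point T l \<longleftrightarrow>
     count T 1 = 1 \<and> (\<forall>k \<in># T - {#1#}. k = l)"

end

theory Submission
  imports Defs
begin

text \<open>
  The dihedral group consists of maps \<open>i \<mapsto> s * i + c\<close> modulo \<open>p\<close> with \<open>s = 1\<close> or \<open>s = - 1\<close>, so an
  element of the coset is affine, \<open>\<sigma> i = u * i + b\<close>, with slope \<open>u = a\<close> or \<open>u = - a\<close>; both slopes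
  occur, for instance in \<open>\<pi>\<^sub>a\<close> and in \<open>\<pi>\<^sub>a \<phi>\<close>.  Since \<open>a\<close> is neither \<open>1\<close> nor \<open>- 1\<close>, the equation
  \<open>(1 - u) * z = b\<close> has a unique solution \<open>z\<close>, which is the fixed point.  Moving the origin there turns \<open>\<sigma>\<close>
  into multiplication by \<open>u\<close>, that is, \<open>\<sigma>\<^sup>n i - z = u^n * (i - z)\<close>.  Hence every other point
  lies on a cycle whose length is the order \<open>l\<close> of \<open>u\<close>, and there are \<open>(p - 1) / l\<close> such cycles
  (\<open>cycle_type_affine\<close>): the cycle type depends on the order of the slope only.

  It remains to compare the orders of \<open>a\<close> and \<open>- a\<close> with the order \<open>m = N - 1\<close> of their common
  square.  As \<open>p\<close> is prime, \<open>u^m\<close> is a square root of \<open>1\<close> and so equals \<open>1\<close> or \<open>- 1\<close>; in the first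
  case \<open>u\<close> has order \<open>m\<close>, in the second \<open>2 * m\<close> (\<open>period_eq_period_of_square\<close> and
  \<open>period_double_period_of_square\<close>).  For even \<open>m\<close> the first case is impossible, because
  then \<open>u^m = (u^2)^(m/2)\<close> with \<open>m/2\<close> smaller than the order of \<open>u^2\<close>; so both slopes have
  order \<open>2 * m\<close>.  For odd \<open>m\<close> we have \<open>(- a)^m = - (a^m)\<close>, so exactly one of the two slopes has
  order \<open>m\<close> and the other one has order \<open>2 * m\<close>.
\<close>

section \<open>Permutations whose cycles, apart from one fixed point, have equal length\<close>

text \<open>
  The points \<open>x, f x, \<dots>, f\<^sup>l\<^sup>-\<^sup>1 x\<close> fill the orbit.  If the \<open>i\<close>-th and the \<open>j\<close>-th of them
  coincided with \<open>i < j\<close>, then another \<open>l - j\<close> steps would bring \<open>x\<close> back to itself after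
  \<open>l - j + i < l\<close> steps.
\<close>

lemma card_orbit_eq_period:
  assumes "l > 0" and period: "\<And>n. (f ^^ n) x = x \<longleftrightarrow> l dvd n"
  shows "card (orbit f x) = l"
proof -
  have no_repeat: False if "(f ^^ i) x = (f ^^ j) x" "i < j" "j < l" for i j
  proof -
    have "(f ^^ (l - j + i)) x = (f ^^ (l - j)) ((f ^^ j) x)"
      using that(1) by (simp add: funpow_add)
    also have "\<dots> = (f ^^ (l - j + j)) x"
      by (simp only: funpow_add o_apply)
    also have "\<dots> = x"
      using that period[of l] by simp
    finally have "l dvd l - j + i"
      by (simp add: period)
    then show False
      using that by (auto dest: dvd_imp_le)
  qed
  have "inj_on (\<lambda>n. (f ^^ n) x) {..<l}"
    by (rule inj_onI) (metis lessThan_iff linorder_neqE_nat no_repeat)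
  moreover have "orbit f x = (\<lambda>n. (f ^^ n) x) ` {..<l}"
    using orbit_altdef_bounded[of l f x] period[of l] assms(1) by auto
  ultimately show ?thesis
    by (simp add: card_image)
qed

text \<open>
  The orbits partition the domain, so the points other than the fixed point are divided into blocks
  of size \<open>l\<close>; counting them gives the number of cycles as well as the divisibility.
\<close>

lemma cycle_type_one_fixed_point:
  assumes "finite S" "\<sigma> permutes S" "z \<in> S" "\<sigma> z = z"
    and len: "\<And>x. x \<in> S - {z} \<Longrightarrow> card (orbit \<sigma> x) = l"
  shows "cycle_type S \<sigma> = add_mset 1 (replicate_mset ((card S - 1) div l) l)"
    and "l dvd card S - 1"
proof -
  define C where "C = orbit \<sigma> ` (S - {z})"
  have perm: "permutation \<sigma>"
    using assms(1,2) permutation_permutes by blast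
  have self: "x \<in> orbit \<sigma> x" for x
    by (rule permutation_self_in_orbit[OF perm])
  have z: "orbit \<sigma> z = {z}"
    using assms(4) by (simp add: orbit_eq_singleton_iff)
  have eqI: "orbit \<sigma> x = orbit \<sigma> y" if "y \<in> orbit \<sigma> x" for x y
    using that by (metis orbit_swap orbit_trans self subsetI subset_antisym)
  have "finite C"
    using assms(1) by (simp add: C_def)
  have "\<Union> C = S - {z}"
  proof
    show "\<Union> C \<subseteq> S - {z}"
    proof
      fix y assume "y \<in> \<Union> C"
      then obtain x where x: "x \<in> S" "x \<noteq> z" "y \<in> orbit \<sigma> x"
        by (auto simp: C_def)
      have "y \<in> S"
        using permutes_orbit_subset[OF assms(2) x(1)] x(3) by blast
      moreover have "y \<noteq> z"
        using eqI[OF x(3)] z self[of x] x(2) by auto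
      ultimately show "y \<in> S - {z}"
        by simp
    qed
    show "S - {z} \<subseteq> \<Union> C"
      using self by (auto simp: C_def)
  qed
  have "l * card C = card (\<Union> C)"
  proof (rule card_partition[OF \<open>finite C\<close>])
    show "finite (\<Union> C)"
      using \<open>\<Union> C = S - {z}\<close> assms(1) by simp
    show "card c = l" if "c \<in> C" for c
      using that len by (auto simp: C_def)
    show "c1 \<inter> c2 = {}" if "c1 \<in> C" "c2 \<in> C" "c1 \<noteq> c2" for c1 c2
      using that eqI unfolding C_def by blast
  qed
  then have count: "l * card C = card S - 1"
    using \<open>\<Union> C = S - {z}\<close> assms(1,3) by simp
  then show "l dvd card S - 1"
    by (metis dvd_triv_left)
  have "(card S - 1) div l = card C"
  proof (cases "C = {}")
    case True
    then show ?thesis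
      using count by (metis card.empty div_0 mult_0_right)
  next
    case False
    then obtain x where "x \<in> S - {z}"
      by (auto simp: C_def)
    then have "l = card (orbit \<sigma> x)" "finite (orbit \<sigma> x)"
      using len finite_orbit[OF self] by auto
    then have "l > 0"
      using self by (metis card_gt_0_iff empty_iff)
    then show ?thesis
      using count by (metis nonzero_mult_div_cancel_left less_numeral_extra(3))
  qed
  moreover have "{z} \<notin> C"
    using \<open>\<Union> C = S - {z}\<close> by blast
  moreover have "orbit \<sigma> ` S = insert {z} C"
    using assms(3) z by (auto simp: C_def)
  moreover have "image_mset card (mset_set C) = replicate_mset (card C) l"
  proof -
    have "image_mset card (mset_set C) = image_mset (\<lambda>_. l) (mset_set C)"
      by (rule image_mset_cong) (use len \<open>finite C\<close> in \<open>auto simp: C_def\<close>)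
    then show ?thesis
      by (simp add: image_mset_const_eq)
  qed
  ultimately show "cycle_type S \<sigma> = add_mset 1 (replicate_mset ((card S - 1) div l) l)"
    using \<open>finite C\<close> by (simp add: cycle_type_def)
qed

lemma all_lengths_but_one_fixed_point_replicate:
  assumes "l > 1"
  shows "all_lengths_but_one_fixed_point (add_mset 1 (replicate_mset k l)) l"
  using assms by (auto simp: all_lengths_but_one_fixed_point_def dest: in_replicate_mset[THEN iffD1])

section \<open>Permutations that are affine modulo p\<close>

lemma residues_1_to_p_eqI:
  assumes "i \<in> {1..p}" "j \<in> {1..p}" "[int i = int j] (mod int p)"
  shows "i = j"
proof -
  have "[int i - 1 = int j - 1] (mod int p)"
    using assms(3) by (rule cong_diff) simp
  then have "int i - 1 = int j - 1"
    by (rule cong_less_imp_eq_int[rotated 4]) (use assms in auto)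
  then show ?thesis by simp
qed

definition affine_perm :: "nat \<Rightarrow> int \<Rightarrow> int \<Rightarrow> (nat \<Rightarrow> nat) \<Rightarrow> bool" where
  "affine_perm p u b \<sigma> \<longleftrightarrow>
     \<sigma> permutes {1..p} \<and> (\<forall>i\<in>{1..p}. [int (\<sigma> i) = u * int i + b] (mod int p))"

lemma affine_perm_residue_map:
  assumes "p > 0" "coprime u (int p)" "\<And>i. f i = u * i + b"
  shows "affine_perm p u b (residue_map p f)"
proof -
  let ?g = "residue_map p f"
  have cong: "[int (?g i) = u * int i + b] (mod int p)" if "i \<in> {1..p}" for i
    using that residue_rep_cong[OF assms(1), of "f (int i)"] by (simp add: residue_map_def assms(3))
  have maps: "?g ` {1..p} \<subseteq> {1..p}"
  proof
    fix y assume "y \<in> ?g ` {1..p}"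
    then obtain i where "i \<in> {1..p}" "y = residue_rep p (f (int i))"
      by (auto simp: residue_map_def)
    then show "y \<in> {1..p}"
      using residue_rep_in[OF assms(1)] by simp
  qed
  have inj: "inj_on ?g {1..p}"
  proof (rule inj_onI)
    fix i j assume ij: "i \<in> {1..p}" "j \<in> {1..p}" "?g i = ?g j"
    then have "[u * int i + b = u * int j + b] (mod int p)"
      using cong[OF ij(1)] cong[OF ij(2)] by (metis cong_sym cong_trans)
    then have "[u * int i = u * int j] (mod int p)"
      by (simp add: cong_add_rcancel)
    then have "[int i = int j] (mod int p)"
      using assms(2) by (simp add: cong_mult_lcancel)
    then show "i = j"
      using ij residues_1_to_p_eqI by blast
  qed
  have "bij_betw ?g {1..p} {1..p}"
    using inj maps by (simp add: bij_betw_def endo_inj_surj)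
  then have "?g permutes {1..p}"
    by (rule bij_imp_permutes) (auto simp: residue_map_def)
  then show ?thesis
    using cong by (simp add: affine_perm_def)
qed

lemma affine_perm_comp:
  assumes "affine_perm p u b \<sigma>" "affine_perm p v c \<tau>"
  shows "affine_perm p (u * v) (u * c + b) (\<sigma> \<circ> \<tau>)"
  unfolding affine_perm_def
proof (intro conjI ballI)
  show "\<sigma> \<circ> \<tau> permutes {1..p}"
    using assms by (simp add: affine_perm_def permutes_compose)
  fix i assume i: "i \<in> {1..p}"
  then have ti: "\<tau> i \<in> {1..p}"
    using assms(2) permutes_in_image unfolding affine_perm_def by metis
  have "[int (\<sigma> (\<tau> i)) = u * int (\<tau> i) + b] (mod int p)"
    using assms(1) ti by (simp add: affine_perm_def)
  also have "[u * int (\<tau> i) + b = u * (v * int i + c) + b] (mod int p)"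
    using assms(2) i by (intro cong_add cong_mult cong_refl) (simp add: affine_perm_def)
  finally show "[int ((\<sigma> \<circ> \<tau>) i) = u * v * int i + (u * c + b)] (mod int p)"
    by (simp add: algebra_simps)
qed

lemma affine_perm_inv:
  assumes "affine_perm p s c \<sigma>" "s * s = 1"
  shows "affine_perm p s (- s * c) (inv' \<sigma>)"
  unfolding affine_perm_def
proof (intro conjI ballI)
  have perm: "\<sigma> permutes {1..p}"
    using assms(1) by (simp add: affine_perm_def)
  then show "inv' \<sigma> permutes {1..p}"
    by (rule permutes_inv)
  fix i assume i: "i \<in> {1..p}"
  then have "inv' \<sigma> i \<in> {1..p}"
    using permutes_in_image[OF permutes_inv[OF perm]] by simp
  then have "[int (\<sigma> (inv' \<sigma> i)) = s * int (inv' \<sigma> i) + c] (mod int p)"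
    using assms(1) by (simp add: affine_perm_def)
  then have "[int i = s * int (inv' \<sigma> i) + c] (mod int p)"
    by (simp add: permutes_inverses(1)[OF perm])
  then have "[s * int i - s * c = s * (s * int (inv' \<sigma> i) + c) - s * c] (mod int p)"
    by (intro cong_diff cong_mult cong_refl)
  moreover have "s * (s * int (inv' \<sigma> i) + c) - s * c = int (inv' \<sigma> i)"
    using assms(2) by (simp add: algebra_simps flip: mult.assoc)
  ultimately show "[int (inv' \<sigma> i) = s * int i + - s * c] (mod int p)"
    by (simp add: cong_sym)
qed

text \<open>
  At a fixed point \<open>z\<close> as origin the map is linear: subtracting \<open>z = u * z + b\<close> from
  \<open>\<sigma> i = u * i + b\<close> leaves \<open>\<sigma> i - z = u * (i - z)\<close>, which can be iterated.
\<close>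

lemma affine_perm_funpow:
  assumes "affine_perm p u b \<sigma>" "i \<in> {1..p}" "[u * z + b = z] (mod int p)"
  shows "(\<sigma> ^^ n) i \<in> {1..p} \<and> [int ((\<sigma> ^^ n) i) - z = u ^ n * (int i - z)] (mod int p)"
proof (induction n)
  case 0
  then show ?case using assms(2) by simp
next
  case (Suc n)
  define j where "j = (\<sigma> ^^ n) i"
  have j: "j \<in> {1..p}" "[int j - z = u ^ n * (int i - z)] (mod int p)"
    using Suc by (simp_all add: j_def)
  have "\<sigma> j \<in> {1..p}"
    using assms(1) j(1) permutes_in_image unfolding affine_perm_def by metis
  moreover have "[int (\<sigma> j) - z = (u * int j + b) - (u * z + b)] (mod int p)"
    using assms(1,3) j(1) by (intro cong_diff) (simp_all add: affine_perm_def cong_sym)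
  moreover have "[u * (int j - z) = u * (u ^ n * (int i - z))] (mod int p)"
    by (intro cong_mult cong_refl j(2))
  ultimately show ?case
    by (auto simp: j_def algebra_simps intro: cong_trans)
qed

text \<open>
  Primality enters twice: it makes \<open>1 - u\<close> invertible, which yields the fixed point \<open>z\<close>, and it
  allows \<open>i - z\<close> to be cancelled from \<open>u^n * (i - z) = i - z\<close>, so that every point other than \<open>z\<close>
  has the order of \<open>u\<close> as its period.
\<close>

lemma cycle_type_affine:
  assumes "Factorial_Ring.prime p" "affine_perm p u b \<sigma>" "l > 1"
    and order: "\<And>n. [u ^ n = 1] (mod int p) \<longleftrightarrow> l dvd n"
  shows "cycle_type {1..p} \<sigma> = add_mset 1 (replicate_mset ((p - 1) div l) l)"
    and "l dvd p - 1"
proof -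
  have "p > 0" and prime: "Factorial_Ring.prime (int p)"
    using assms(1) by (auto simp: prime_gt_0_nat)
  have "\<not> int p dvd u - 1"
    using order[of 1] assms(3) by (simp add: cong_iff_dvd_diff)
  then have "coprime (u - 1) (int p)"
    using prime prime_imp_coprime coprime_commute by blast
  then obtain w where w: "[(u - 1) * w = 1] (mod int p)"
    using cong_solve_coprime_int by blast
  define z where "z = residue_rep p (- w * b)"
  have z: "z \<in> {1..p}" "[int z = - w * b] (mod int p)"
    unfolding z_def using \<open>p > 0\<close> by (rule residue_rep_in, rule residue_rep_cong)
  have "[u * int z + b - int z = (u - 1) * int z + b] (mod int p)"
    by (simp add: algebra_simps)
  also have "[(u - 1) * int z + b = (u - 1) * (- w * b) + b] (mod int p)"
    by (intro cong_add cong_mult cong_refl z(2))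
  also have "(u - 1) * (- w * b) + b = - ((u - 1) * w) * b + b"
    by (simp add: algebra_simps)
  also have "[\<dots> = - 1 * b + b] (mod int p)"
    using w by (intro cong_add cong_mult cong_refl) (simp only: cong_minus_minus_iff)
  finally have zfix: "[u * int z + b = int z] (mod int p)"
    by (simp add: cong_iff_dvd_diff)
  have perm: "\<sigma> permutes {1..p}"
    using assms(2) by (simp add: affine_perm_def)
  have "\<sigma> z \<in> {1..p}"
    using z(1) permutes_in_image[OF perm] by metis
  moreover have "[int (\<sigma> z) = int z] (mod int p)"
    using assms(2) z(1) zfix by (auto simp: affine_perm_def intro: cong_trans)
  ultimately have fixed: "\<sigma> z = z"
    using z(1) residues_1_to_p_eqI by blast
  have len: "card (orbit \<sigma> i) = l" if i: "i \<in> {1..p} - {z}" for i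
  proof (rule card_orbit_eq_period)
    show "l > 0" using assms(3) by simp
    fix n
    have pow: "(\<sigma> ^^ n) i \<in> {1..p}"
      "[int ((\<sigma> ^^ n) i) - int z = u ^ n * (int i - int z)] (mod int p)"
      using affine_perm_funpow[OF assms(2) _ zfix, of i n] i by auto
    have "\<not> int p dvd int i - int z"
      using i z(1) residues_1_to_p_eqI[of i p z] by (auto simp: cong_iff_dvd_diff)
    then have coprime: "coprime (int i - int z) (int p)"
      using prime prime_imp_coprime coprime_commute by blast
    have "(\<sigma> ^^ n) i = i \<longleftrightarrow> [int ((\<sigma> ^^ n) i) = int i] (mod int p)"
      using pow(1) i residues_1_to_p_eqI[of "(\<sigma> ^^ n) i" p i] by (metis DiffD1 cong_refl)
    also have "\<dots> \<longleftrightarrow> [int ((\<sigma> ^^ n) i) - int z = int i - int z] (mod int p)"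
      by (simp add: cong_iff_dvd_diff)
    also have "\<dots> \<longleftrightarrow> [u ^ n * (int i - int z) = 1 * (int i - int z)] (mod int p)"
      using pow(2) by (auto simp: cong_def)
    also have "\<dots> \<longleftrightarrow> l dvd n"
      using cong_mult_rcancel[OF coprime, of "u ^ n" 1] order by simp
    finally show "(\<sigma> ^^ n) i = i \<longleftrightarrow> l dvd n" .
  qed
  show "cycle_type {1..p} \<sigma> = add_mset 1 (replicate_mset ((p - 1) div l) l)" "l dvd p - 1"
    using cycle_type_one_fixed_point[OF _ perm z(1) fixed len] by simp_all
qed

section \<open>The slopes that occur in the coset\<close>

text \<open>
  The affine permutations with slope \<open>1\<close> or \<open>- 1\<close> form a subgroup of the symmetric group, and both
  generators of the dihedral group lie in it.
\<close>

lemma dihedral_affine: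
  assumes "p > 0" "d \<in> dihedral p"
  obtains s c where "s = 1 \<or> s = - 1" "affine_perm p s c d"
proof -
  let ?H = "{d. \<exists>s c. (s = 1 \<or> s = - 1) \<and> affine_perm p s c d}"
  interpret group "sym_group p" by (rule sym_group_is_group)
  have carrier: "d \<in> carrier (sym_group p)" if "d \<in> ?H" for d
    using that by (auto simp: affine_perm_def sym_group_carrier)
  have "subgroup ?H (sym_group p)"
  proof (rule subgroupI)
    show "?H \<subseteq> carrier (sym_group p)"
      using carrier by blast
    have "affine_perm p 1 0 id"
      by (simp add: affine_perm_def permutes_id)
    then show "?H \<noteq> {}" by blast
  next
    fix d assume d: "d \<in> ?H"
    then obtain s c where s: "s = 1 \<or> s = - 1" and aff: "affine_perm p s c d"
      by blast
    have "affine_perm p s (- s * c) (inv' d)"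
      using s by (intro affine_perm_inv aff) auto
    moreover have "inv\<^bsub>sym_group p\<^esub> d = inv' d"
      using d carrier permutes_inv_o(2) sym_group_inv_closed
      by (intro inv_equality) (auto simp: sym_group_mult sym_group_one sym_group_carrier)
    ultimately show "inv\<^bsub>sym_group p\<^esub> d \<in> ?H"
      using s by auto
  next
    fix d e assume "d \<in> ?H" "e \<in> ?H"
    then obtain s c t k where "s = 1 \<or> s = - 1" "t = 1 \<or> t = - 1"
      "affine_perm p s c d" "affine_perm p t k e"
      by blast
    then have "s * t = 1 \<or> s * t = - 1" "affine_perm p (s * t) (s * k + c) (d \<circ> e)"
      using affine_perm_comp by auto
    then show "d \<otimes>\<^bsub>sym_group p\<^esub> e \<in> ?H"
      by (auto simp: sym_group_mult)
  qed
  moreover have "affine_perm p (- 1) 1 (flip p)" "affine_perm p 1 1 (cyclic_shift p)"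
    unfolding flip_def cyclic_shift_def using assms(1)
    by (auto intro!: affine_perm_residue_map)
  then have "{flip p, cyclic_shift p} \<subseteq> ?H"
    by blast
  ultimately have "dihedral p \<subseteq> ?H"
    unfolding dihedral_def by (intro generate_subgroup_incl)
  then show thesis
    using assms(2) that by blast
qed

lemma dihedral_coset_affine:
  assumes "p > 0" "coprime a (int p)" "\<sigma> \<in> dihedral_coset p a"
  shows "\<exists>b. affine_perm p a b \<sigma> \<or> affine_perm p (- a) b \<sigma>"
proof -
  obtain d where d: "d \<in> dihedral p" "\<sigma> = mult_perm p a \<circ> d"
    using assms(3) by (auto simp: dihedral_coset_def l_coset_def sym_group_mult)
  obtain s c where s: "s = 1 \<or> s = - 1" "affine_perm p s c d"
    using dihedral_affine[OF assms(1) d(1)] .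
  have "affine_perm p a 0 (mult_perm p a)"
    unfolding mult_perm_def using assms by (intro affine_perm_residue_map) auto
  from affine_perm_comp[OF this s(2)] show ?thesis
    using s(1) d(2) by auto
qed

text \<open>
  The identity and the flip are dihedral, and multiplied by \<open>\<pi>\<^sub>a\<close> they have slopes \<open>a\<close> and \<open>- a\<close>.
\<close>

lemma dihedral_coset_both_slopes:
  assumes "p > 0" "coprime a (int p)"
  obtains \<sigma> \<tau> b c where "\<sigma> \<in> dihedral_coset p a" "affine_perm p a b \<sigma>"
    "\<tau> \<in> dihedral_coset p a" "affine_perm p (- a) c \<tau>"
proof -
  have a: "affine_perm p a 0 (mult_perm p a)"
    unfolding mult_perm_def using assms by (intro affine_perm_residue_map) auto
  have "affine_perm p (- 1) 1 (flip p)"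
    unfolding flip_def using assms(1) by (intro affine_perm_residue_map) auto
  from affine_perm_comp[OF a this] have "affine_perm p (- a) a (mult_perm p a \<circ> flip p)"
    by simp
  moreover have "id \<in> dihedral p" "flip p \<in> dihedral p"
    unfolding dihedral_def
    by (metis generate.one sym_group_one) (simp add: generate.incl)
  then have "mult_perm p a \<circ> id \<in> dihedral_coset p a"
    "mult_perm p a \<circ> flip p \<in> dihedral_coset p a"
    unfolding dihedral_coset_def l_coset_def sym_group_mult by blast+
  ultimately show thesis
    using that a by simp
qed

section \<open>The order of a residue and the order of its square\<close>

lemma ord_mod_square:
  assumes "Factorial_Ring.prime p" "panmagic p a"
  shows "[(a\<^sup>2) ^ n = 1] (mod int p) \<longleftrightarrow>
    ord_mod p (a [^]\<^bsub>residue_ring (int p)\<^esub> (2::nat)) dvd n"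
proof -
  let ?R = "residue_ring (int p)"
  interpret residues "int p" ?R
    using prime_gt_1_nat[OF assms(1)] by unfold_locales auto
  interpret U: group "units_of ?R" by (rule units_group)
  have unit: "a \<in> Units ?R"
    using assms(2) by (simp add: panmagic_def Let_def)
  then have unit2: "a [^]\<^bsub>?R\<^esub> (2::nat) \<in> Units ?R"
    by (rule Units_pow_closed)
  have "a mod int p = a"
    using unit by (simp add: res_units_eq)
  then have "a [^]\<^bsub>?R\<^esub> (2 * n) = a ^ (2 * n) mod int p"
    using pow_cong[of a "2 * n"] by simp
  then have "[(a\<^sup>2) ^ n = 1] (mod int p) \<longleftrightarrow> a [^]\<^bsub>?R\<^esub> (2 * n) = \<one>\<^bsub>?R\<^esub>"
    by (metis cong_def one_cong power_mult)
  also have "a [^]\<^bsub>?R\<^esub> (2 * n) = (a [^]\<^bsub>?R\<^esub> (2::nat)) [^]\<^bsub>?R\<^esub> n"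
    using unit by (simp add: nat_pow_pow Units_closed)
  also have "\<dots> = (a [^]\<^bsub>?R\<^esub> (2::nat)) [^]\<^bsub>units_of ?R\<^esub> n"
    using unit2 by (simp add: units_of_pow)
  also have "\<dots> = \<one>\<^bsub>?R\<^esub> \<longleftrightarrow> ord_mod p (a [^]\<^bsub>?R\<^esub> (2::nat)) dvd n"
    using U.pow_eq_id unit2 by (simp add: ord_mod_def units_of_carrier units_of_one)
  finally show ?thesis .
qed

lemma panmagic_not_cong:
  assumes "Factorial_Ring.prime p" "panmagic p a"
  shows "coprime a (int p)" "\<not> [a = 1] (mod int p)" "\<not> [a = - 1] (mod int p)"
proof -
  let ?R = "residue_ring (int p)"
  interpret residues "int p" ?R
    using prime_gt_1_nat[OF assms(1)] by unfold_locales auto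
  have units: "a \<in> Units ?R" "a \<oplus>\<^bsub>?R\<^esub> \<one>\<^bsub>?R\<^esub> \<in> Units ?R" "a \<ominus>\<^bsub>?R\<^esub> \<one>\<^bsub>?R\<^esub> \<in> Units ?R"
    using assms(2) by (simp_all add: panmagic_def Let_def)
  show "coprime a (int p)"
    using units(1) by (simp add: res_units_eq)
  have "(a + 1) mod int p \<noteq> 0"
    using units(2) by (simp add: res_units_eq res_add_eq res_one_eq)
  then show "\<not> [a = - 1] (mod int p)"
    by (simp add: cong_iff_dvd_diff dvd_eq_mod_eq_0)
  have "(a - 1) mod int p \<noteq> 0"
    using units(3) by (simp add: res_units_eq res_add_eq res_one_eq res_neg_eq a_minus_def mod_add_right_eq)
  then show "\<not> [a = 1] (mod int p)"
    by (simp add: cong_iff_dvd_diff dvd_eq_mod_eq_0)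
qed

text \<open>
  Let \<open>m\<close> be the order of \<open>u^2\<close>.  Squaring \<open>u^n = 1\<close> gives \<open>(u^2)^n = 1\<close>, so \<open>n\<close> is a multiple
  \<open>m * k\<close> and \<open>u^n = (u^m)^k\<close>.  If \<open>u^m = 1\<close> this equals \<open>1\<close> for every \<open>k\<close>; if \<open>u^m = - 1\<close> it equals
  \<open>1\<close> exactly for even \<open>k\<close>, as long as the modulus distinguishes \<open>1\<close> from \<open>- 1\<close>.
\<close>

lemma period_eq_period_of_square:
  fixes u M :: int
  assumes order: "\<And>n. [(u\<^sup>2) ^ n = 1] (mod M) \<longleftrightarrow> m dvd n" and "[u ^ m = 1] (mod M)"
  shows "[u ^ n = 1] (mod M) \<longleftrightarrow> m dvd n"
proof
  assume "[u ^ n = 1] (mod M)"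
  then have "[(u ^ n)\<^sup>2 = 1\<^sup>2] (mod M)"
    by (rule cong_pow)
  then show "m dvd n"
    using order[of n] by (simp add: power_commutes flip: power_mult) (simp add: mult.commute)
next
  assume "m dvd n"
  then obtain k where "n = m * k" by blast
  then show "[u ^ n = 1] (mod M)"
    using cong_pow[OF assms(2), of k] by (simp add: power_mult)
qed

lemma period_double_period_of_square:
  fixes u M :: int
  assumes order: "\<And>n. [(u\<^sup>2) ^ n = 1] (mod M) \<longleftrightarrow> m dvd n" and "[u ^ m = - 1] (mod M)" "M > 2"
  shows "[u ^ n = 1] (mod M) \<longleftrightarrow> 2 * m dvd n"
proof
  assume u: "[u ^ n = 1] (mod M)"
  then have "[(u ^ n)\<^sup>2 = 1\<^sup>2] (mod M)"
    by (rule cong_pow)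
  then have "m dvd n"
    using order[of n] by (simp add: power_commutes flip: power_mult) (simp add: mult.commute)
  then obtain k where k: "n = m * k" by blast
  have pow: "[u ^ n = (- 1) ^ k] (mod M)"
    using cong_pow[OF assms(2), of k] by (simp add: k power_mult)
  have "even k"
  proof (rule ccontr)
    assume "odd k"
    then have "[1 = - 1] (mod M)"
      using pow u by (metis cong_sym cong_trans neg_one_odd_power)
    then have "M dvd 2"
      by (simp add: cong_iff_dvd_diff)
    then show False
      using \<open>M > 2\<close> zdvd_imp_le by fastforce
  qed
  then show "2 * m dvd n"
    using k by (auto simp: dvd_def)
next
  assume "2 * m dvd n"
  then obtain k where "n = 2 * m * k" ..
  then have "n = m * (2 * k)" by simp
  moreover have "[u ^ (m * (2 * k)) = (- 1) ^ (2 * k)] (mod M)"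
    using cong_pow[OF assms(2), of "2 * k"] by (simp only: power_mult)
  ultimately show "[u ^ n = 1] (mod M)"
    by simp
qed

section \<open>The cycle types in the coset\<close>

theorem theorem6:
  fixes p N :: nat and a :: int
  assumes "Factorial_Ring.prime p" and "p \<ge> 5"
    and "panmagic p a"
    and "N = ord_mod p (a [^]\<^bsub>residue_ring (int p)\<^esub> (2::nat)) + 1"
  shows "(odd N \<longrightarrow>
           (\<exists>T. cycle_type {1..p} ` dihedral_coset p a = {T} \<and>
                all_lengths_but_one_fixed_point T (2 * (N - 1)))) \<and>
         (even N \<longrightarrow>
           (\<exists>T1 T2. T1 \<noteq> T2 \<and>
                cycle_type {1..p} ` dihedral_coset p a = {T1, T2} \<and>
                all_lengths_but_one_fixed_point T1 (N - 1) \<and>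
                all_lengths_but_one_fixed_point T2 (2 * (N - 1))))"
proof -
  define m where "m = ord_mod p (a [^]\<^bsub>residue_ring (int p)\<^esub> (2::nat))"
  define T where "T l = add_mset 1 (replicate_mset ((p - 1) div l) l)" for l :: nat
  note slopes = panmagic_not_cong[OF assms(1,3)]
  have "p > 0" and prime: "Factorial_Ring.prime (int p)"
    using assms(1) by (auto simp: prime_gt_0_nat)
  have order: "[(a\<^sup>2) ^ n = 1] (mod int p) \<longleftrightarrow> m dvd n" for n
    unfolding m_def by (rule ord_mod_square[OF assms(1,3)])
  have order_slope: "[(u\<^sup>2) ^ n = 1] (mod int p) \<longleftrightarrow> m dvd n" if "u = a \<or> u = - a" for u n
  proof -
    have "u\<^sup>2 = a\<^sup>2"
      using that by auto
    then show ?thesis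
      by (simp only: order)
  qed
  have sqrt_one: "[x = 1] (mod int p) \<or> [x = - 1] (mod int p)" if "[x\<^sup>2 = 1] (mod int p)" for x
  proof -
    have "int p dvd (x - 1) * (x + 1)"
      using that by (simp add: cong_iff_dvd_diff power2_eq_square algebra_simps)
    then show ?thesis
      using prime_dvd_multD[OF prime] by (auto simp: cong_iff_dvd_diff)
  qed
  \<comment> \<open>Cycles of length \<open>1\<close> would be further fixed points.\<close>
  have "m \<noteq> 1"
    using order[of 1] sqrt_one[of a] slopes by auto
  \<comment> \<open>An element of infinite order would have \<open>m = 0\<close>; Euler's theorem excludes this.\<close>
  have "m > 0"
  proof -
    interpret residues "int p" "residue_ring (int p)"
      using \<open>p \<ge> 5\<close> by unfold_locales auto
    have "[(a\<^sup>2) ^ totient p = 1] (mod int p)"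
      using euler_theorem[of "a\<^sup>2"] slopes(1) by simp
    then show ?thesis
      using order[of "totient p"] \<open>p > 0\<close> by (intro Nat.gr0I) auto
  qed
  have am: "[a ^ m = 1] (mod int p) \<or> [a ^ m = - 1] (mod int p)"
    using order[of m] by (intro sqrt_one) (simp add: power_commutes flip: power_mult, simp add: mult.commute)
  have type_m: "cycle_type {1..p} \<sigma> = T m"
    if "affine_perm p u b \<sigma>" "u = a \<or> u = - a" "[u ^ m = 1] (mod int p)" for u b \<sigma>
    unfolding T_def
  proof (rule cycle_type_affine(1)[OF assms(1) that(1)])
    show "m > 1" using \<open>m > 0\<close> \<open>m \<noteq> 1\<close> by simp
    show "[u ^ n = 1] (mod int p) \<longleftrightarrow> m dvd n" for n
      by (rule period_eq_period_of_square[OF order_slope[OF that(2)] that(3)])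
  qed
  have period2: "[u ^ n = 1] (mod int p) \<longleftrightarrow> 2 * m dvd n"
    if "u = a \<or> u = - a" "[u ^ m = - 1] (mod int p)" for u n
    by (rule period_double_period_of_square[OF order_slope[OF that(1)] that(2)])
      (use \<open>p \<ge> 5\<close> in simp)
  have type_2m: "cycle_type {1..p} \<sigma> = T (2 * m)"
    if "affine_perm p u b \<sigma>" "u = a \<or> u = - a" "[u ^ m = - 1] (mod int p)" for u b \<sigma>
    unfolding T_def
    by (rule cycle_type_affine(1)[OF assms(1) that(1) _ period2[OF that(2,3)]])
      (use \<open>m > 0\<close> in simp)
  have lengths: "all_lengths_but_one_fixed_point (T l) l" if "l > 1" for l
    unfolding T_def using that by (rule all_lengths_but_one_fixed_point_replicate)
  note in_coset = dihedral_coset_affine[OF \<open>p > 0\<close> slopes(1)]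
  obtain \<sigma> \<tau> b c where \<sigma>: "\<sigma> \<in> dihedral_coset p a" "affine_perm p a b \<sigma>"
    and \<tau>: "\<tau> \<in> dihedral_coset p a" "affine_perm p (- a) c \<tau>"
    using dihedral_coset_both_slopes[OF \<open>p > 0\<close> slopes(1)] .
  have N: "N = m + 1"
    using assms(4) by (simp add: m_def)
  show ?thesis
  proof (intro conjI impI)
    assume "odd N"
    then have "even m" by (simp add: N)
    then obtain h where h: "m = 2 * h" by blast
    \<comment> \<open>If \<open>a^m = 1\<close>, then \<open>(a^2)^h = 1\<close> although \<open>0 < h < m\<close>.\<close>
    have "\<not> m dvd h"
      using h \<open>m > 0\<close> by (auto dest: dvd_imp_le)
    then have "\<not> [a ^ m = 1] (mod int p)"
      using order[of h] by (simp add: h power_mult)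
    then have "[a ^ m = - 1] (mod int p)" "[(- a) ^ m = - 1] (mod int p)"
      using am \<open>even m\<close> by simp_all
    then have "cycle_type {1..p} \<rho> = T (2 * m)" if "\<rho> \<in> dihedral_coset p a" for \<rho>
      using in_coset[OF that] type_2m by blast
    then have "cycle_type {1..p} ` dihedral_coset p a = {T (2 * m)}"
      using \<sigma>(1) by (force simp: image_iff)
    then show "\<exists>T. cycle_type {1..p} ` dihedral_coset p a = {T} \<and>
        all_lengths_but_one_fixed_point T (2 * (N - 1))"
      using lengths[of "2 * m"] \<open>m > 0\<close> N by auto
  next
    assume "even N"
    then have "odd m" by (simp add: N)
    have "\<exists>u v. {u, v} = {a, - a} \<and> [u ^ m = 1] (mod int p) \<and> [v ^ m = - 1] (mod int p)"
      using am
    proof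
      assume "[a ^ m = 1] (mod int p)"
      moreover from this have "[(- a) ^ m = - 1] (mod int p)"
        using \<open>odd m\<close> by (simp add: cong_minus_minus_iff)
      ultimately show ?thesis by blast
    next
      assume "[a ^ m = - 1] (mod int p)"
      moreover from this have "[(- a) ^ m = 1] (mod int p)"
        using \<open>odd m\<close> cong_minus_minus_iff[of "a ^ m" "- 1" "int p"] by simp
      ultimately show ?thesis by (metis insert_commute)
    qed
    then obtain u v where uv: "{u, v} = {a, - a}"
      and u: "[u ^ m = 1] (mod int p)" and v: "[v ^ m = - 1] (mod int p)"
      by blast
    have u': "u = a \<or> u = - a" and v': "v = a \<or> v = - a"
      using uv by blast+
    obtain \<sigma>' b' where \<sigma>': "\<sigma>' \<in> dihedral_coset p a" "affine_perm p u b' \<sigma>'"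
      using u' \<sigma> \<tau> by blast
    obtain \<tau>' c' where \<tau>': "\<tau>' \<in> dihedral_coset p a" "affine_perm p v c' \<tau>'"
      using v' \<sigma> \<tau> by blast
    have "cycle_type {1..p} \<rho> = T m \<or> cycle_type {1..p} \<rho> = T (2 * m)"
      if \<rho>: "\<rho> \<in> dihedral_coset p a" for \<rho>
    proof -
      have "\<exists>k. affine_perm p u k \<rho> \<or> affine_perm p v k \<rho>"
        using in_coset[OF \<rho>] uv by (metis doubleton_eq_iff)
      then show ?thesis
        using type_m[OF _ u' u] type_2m[OF _ v' v] by blast
    qed
    moreover have "cycle_type {1..p} \<sigma>' = T m" "cycle_type {1..p} \<tau>' = T (2 * m)"
      using type_m[OF \<sigma>'(2) u' u] type_2m[OF \<tau>'(2) v' v] by auto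
    ultimately have "cycle_type {1..p} ` dihedral_coset p a = {T m, T (2 * m)}"
      using \<sigma>'(1) \<tau>'(1) by (auto simp: image_iff) metis+
    \<comment> \<open>The two multisets differ because there is at least one cycle of length \<open>2 * m\<close>.\<close>
    moreover have "T m \<noteq> T (2 * m)"
    proof
      assume eq: "T m = T (2 * m)"
      have "2 * m dvd p - 1"
        using cycle_type_affine(2)[OF assms(1) \<tau>'(2) _ period2[OF v' v]] \<open>m > 0\<close> by simp
      then have "(p - 1) div (2 * m) > 0"
        using \<open>p \<ge> 5\<close> \<open>m > 0\<close> by (auto simp: div_greater_zero_iff dest: dvd_imp_le)
      then have "2 * m \<in># replicate_mset ((p - 1) div m) m"
        using eq by (auto simp: T_def)
      then show False
        using \<open>m > 0\<close> by (simp split: if_splits)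
    qed
    moreover have "m > 1"
      using \<open>m > 0\<close> \<open>m \<noteq> 1\<close> by simp
    ultimately show "\<exists>T1 T2. T1 \<noteq> T2 \<and>
        cycle_type {1..p} ` dihedral_coset p a = {T1, T2} \<and>
        all_lengths_but_one_fixed_point T1 (N - 1) \<and>
        all_lengths_but_one_fixed_point T2 (2 * (N - 1))"
      using lengths[of m] lengths[of "2 * m"] N
      by (intro exI[of _ "T m"] exI[of _ "T (2 * m)"]) simp
  qed
qed

end
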